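(* Let $F$ be a bounded, compact and full-dimensional subset of the elliptic plane. Among all conics with two given axes $X,Y$ that contain $F$ there exists exactly one of minimal area.
   Context: The elliptic plane is the unit sphere $S^2\subset\mathbb{R}^3$ with antipodal points identified; its lines are the images of great circles (intersections of $S^2$ with two-dimensional linear subspaces), and area is inherited from $S^2$ (the whole elliptic plane has area $2\pi$). A conic is a set $C=\{x\in S^2 : x^{T}Mx=0\}$ where $M\in\mathbb{R}^{3\times 3}$ is symmetric, invertible and indefinite, scaled so that it has eigenvalues $\nu_1\ge\nu_2>0$ and $\nu_3=-1$. Its interior is $\{x\in S^2 : x^{T}Mx<0\}$. A conic $C$ contains (encloses) a set $F$ if $x^{T}Mx\le 0$ for all $x\in F$. The center of $C$ is the point $c$ spanned by an eigenvector for the eigenvalue $-1$; the axes of $C$ are the two lines joining $c$ with the points spanned by two orthogonal eigenvectors for $\nu_1$ and $\nu_2$. (If $\nu_1=\nu_2$, the conic is a circle, and any two orthogonal lines through $c$ may serve as axes.) Thus two given axes $X,Y$ are two lines meeting orthogonally in the common center, and in a suitable orthonormal basis the conics with axes $X,Y$ are those with matrix $M=\operatorname{diag}(\mu_1,\mu_2,-1)$, $\mu_1,\mu_2>0$. The area of $C$ is the area of its interior in the elliptic plane, namely $$2\pi-\int_{-\pi}^{\pi}\sqrt{\frac{\nu_1\sin^2\varphi+\nu_2\cos^2\varphi}{1+\nu_1\sin^2\varphi+\nu_2\cos^2\varphi}}\,d\varphi .$$ A subset of the elliptic plane is called bounded if it is contained in a circle (a conic with $\nu_1=\nu_2$), and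 full-dimensional if it is not contained in a line.
   Formalization: It is additionally assumed that at least one conic with axes X, Y contains F; boundedness alone does not give this: a small closed cap about a point on the polar line of the center is bounded, compact and full-dimensional, but no conic with axes X, Y contains it. *)

theory Defs
  imports "HOL-Analysis.Analysis"
begin

section \<open>The elliptic plane\<close>

definition ell_point :: "real^3 \<Rightarrow> (real^3) set" where
  "ell_point x = {x, - x}"

definition elliptic_plane :: "(real^3) set set" where
  "elliptic_plane = ell_point ` sphere 0 1"

definition sphere_lift :: "(real^3) set set \<Rightarrow> (real^3) set" where
  "sphere_lift A = {x \<in> sphere 0 1. ell_point x \<in> A}"

definition elliptic_topology :: "(real^3) set topology" where
  "elliptic_topology = topology (\<lambda>U. U \<subseteq> elliptic_plane \<and>
     openin (top_of_set (sphere 0 1)) (sphere_lift U))"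

lemma openin_elliptic_topology:
  "openin elliptic_topology U \<longleftrightarrow>
     U \<subseteq> elliptic_plane \<and> openin (top_of_set (sphere 0 1)) (sphere_lift U)"
proof -
  have lift_Int: "sphere_lift (S \<inter> T) = sphere_lift S \<inter> sphere_lift T" for S T
    by (auto simp: sphere_lift_def)
  have lift_Un: "sphere_lift (\<Union>K) = \<Union>(sphere_lift ` K)" for K
    by (auto simp: sphere_lift_def)
  have "istopology (\<lambda>U. U \<subseteq> elliptic_plane \<and>
          openin (top_of_set (sphere 0 1)) (sphere_lift U))"
    unfolding istopology_def by (auto simp: lift_Int lift_Un)
  then show ?thesis
    by (simp add: elliptic_topology_def topology_inverse')
qed

lemma topspace_elliptic_topology: "topspace elliptic_topology = elliptic_plane"
proof -
  have "sphere_lift elliptic_plane = sphere 0 1"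
    by (auto simp: sphere_lift_def elliptic_plane_def)
  then have "openin elliptic_topology elliptic_plane"
    by (simp add: openin_elliptic_topology)
  then show ?thesis
    unfolding topspace_def using openin_elliptic_topology by blast
qed

lemma quotient_map_ell_point:
  "quotient_map (top_of_set (sphere 0 1)) elliptic_topology ell_point"
  unfolding quotient_map_def topspace_elliptic_topology
  by (auto simp: openin_elliptic_topology elliptic_plane_def sphere_lift_def)

text \<open>Surface area on the sphere is three times the volume of the solid cone over the
  region with apex at the center of the unit ball; every point of the elliptic plane is
  covered twice by the sphere.\<close>

definition sphere_area :: "(real^3) set \<Rightarrow> real" where
  "sphere_area U = 3 * measure lebesgue {r *\<^sub>R x | r x. 0 \<le> r \<and> r \<le> 1 \<and> x \<in> U}"

definition elliptic_area :: "(real^3) set set \<Rightarrow> real" where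
  "elliptic_area A = sphere_area (sphere_lift A) / 2"

lemma elliptic_area_elliptic_plane: "elliptic_area elliptic_plane = 2 * pi"
proof -
  have lift: "sphere_lift elliptic_plane = sphere 0 1"
    by (auto simp: sphere_lift_def elliptic_plane_def)
  have "{r *\<^sub>R x | r x. 0 \<le> r \<and> r \<le> 1 \<and> x \<in> sphere 0 1} = cball (0::real^3) 1"
  proof (intro equalityI subsetI)
    fix y :: "real^3" assume y: "y \<in> cball 0 1"
    show "y \<in> {r *\<^sub>R x | r x. 0 \<le> r \<and> r \<le> 1 \<and> x \<in> sphere 0 1}"
    proof (cases "y = 0")
      case True
      obtain x :: "real^3" where "norm x = 1"
        using vector_choose_size[of 1] by auto
      then show ?thesis using True by (intro CollectI exI[of _ 0] exI[of _ x]) auto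
    next
      case False
      then show ?thesis using y
        by (intro CollectI exI[of _ "norm y"] exI[of _ "y /\<^sub>R norm y"]) auto
    qed
  qed auto
  then show ?thesis
    by (simp add: elliptic_area_def sphere_area_def lift content_cball unit_ball_vol_3)
qed

definition line_through :: "real^3 \<Rightarrow> real^3 \<Rightarrow> (real^3) set set" where
  "line_through u v = ell_point ` (sphere 0 1 \<inter> span {u, v})"

definition ell_line :: "(real^3) set set \<Rightarrow> bool" where
  "ell_line L \<longleftrightarrow> (\<exists>V. subspace V \<and> dim V = 2 \<and> L = ell_point ` (sphere 0 1 \<inter> V))"

text \<open>\<^term>\<open>c\<close> spans the point of intersection; \<^term>\<open>u\<close> and \<^term>\<open>v\<close> are the tangent
  directions of the two great circles there.\<close>

definition orthogonal_lines :: "(real^3) set set \<Rightarrow> (real^3) set set \<Rightarrow> bool" where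
  "orthogonal_lines X Y \<longleftrightarrow>
     (\<exists>c u v. c \<noteq> 0 \<and> u \<noteq> 0 \<and> v \<noteq> 0 \<and> c \<bullet> u = 0 \<and> c \<bullet> v = 0 \<and> u \<bullet> v = 0 \<and>
        X = line_through c u \<and> Y = line_through c v)"

section \<open>Conics\<close>

text \<open>The eigenvalues are counted with multiplicity, through the characteristic polynomial
  (\<^term>\<open>mat t\<close> is \<^term>\<open>t\<close> times the identity matrix). Invertibility and indefiniteness are
  implied by the signs of the eigenvalues.\<close>

definition conic_eigenvalues :: "real^3^3 \<Rightarrow> real \<Rightarrow> real \<Rightarrow> bool" where
  "conic_eigenvalues M \<nu>1 \<nu>2 \<longleftrightarrow>
     transpose M = M \<and> \<nu>1 \<ge> \<nu>2 \<and> \<nu>2 > 0 \<and>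
     (\<forall>t. det (mat t - M) = (t - \<nu>1) * (t - \<nu>2) * (t - (-1)))"

definition conic_matrix :: "real^3^3 \<Rightarrow> bool" where
  "conic_matrix M \<longleftrightarrow> (\<exists>\<nu>1 \<nu>2. conic_eigenvalues M \<nu>1 \<nu>2)"

definition conic :: "real^3^3 \<Rightarrow> (real^3) set set" where
  "conic M = ell_point ` {x \<in> sphere 0 1. x \<bullet> (M *v x) = 0}"

definition conic_interior :: "real^3^3 \<Rightarrow> (real^3) set set" where
  "conic_interior M = ell_point ` {x \<in> sphere 0 1. x \<bullet> (M *v x) < 0}"

definition conic_area :: "real^3^3 \<Rightarrow> real" where
  "conic_area M = elliptic_area (conic_interior M)"

definition encloses :: "real^3^3 \<Rightarrow> (real^3) set set \<Rightarrow> bool" where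
  "encloses M F \<longleftrightarrow> (\<forall>x \<in> sphere_lift F. x \<bullet> (M *v x) \<le> 0)"

text \<open>The pair of axes is unordered. If \<open>\<nu>1 = \<nu>2\<close>, every pair of orthogonal vectors in the
  common eigenspace is admitted.\<close>

definition has_axes :: "real^3^3 \<Rightarrow> (real^3) set set \<Rightarrow> (real^3) set set \<Rightarrow> bool" where
  "has_axes M X Y \<longleftrightarrow>
     (\<exists>\<nu>1 \<nu>2 c v1 v2. conic_eigenvalues M \<nu>1 \<nu>2 \<and> c \<noteq> 0 \<and> v1 \<noteq> 0 \<and> v2 \<noteq> 0 \<and>
        M *v c = (-1) *\<^sub>R c \<and> M *v v1 = \<nu>1 *\<^sub>R v1 \<and> M *v v2 = \<nu>2 *\<^sub>R v2 \<and> v1 \<bullet> v2 = 0 \<and>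
        {X, Y} = {line_through c v1, line_through c v2})"

definition conic_enclosing_with_axes ::
  "(real^3) set set \<Rightarrow> (real^3) set set \<Rightarrow> (real^3) set set \<Rightarrow> real^3^3 \<Rightarrow> bool" where
  "conic_enclosing_with_axes F X Y M \<longleftrightarrow> conic_matrix M \<and> has_axes M X Y \<and> encloses M F"

definition ell_bounded :: "(real^3) set set \<Rightarrow> bool" where
  "ell_bounded F \<longleftrightarrow> F \<subseteq> elliptic_plane \<and> (\<exists>M \<nu>. conic_eigenvalues M \<nu> \<nu> \<and> encloses M F)"

definition full_dimensional :: "(real^3) set set \<Rightarrow> bool" where
  "full_dimensional F \<longleftrightarrow> \<not> (\<exists>L. ell_line L \<and> F \<subseteq> L)"

text \<open>The circle in the definition of boundedness may have any center. Hence a bounded set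
  can meet the polar line of the point \<open>X \<inter> Y\<close>, and then, by the following lemma, no conic
  with axes \<open>X\<close>, \<open>Y\<close> contains it.\<close>

lemma conic_positive_on_polar_of_center:
  assumes M: "conic_eigenvalues M \<nu>1 \<nu>2"
    and nz: "c \<noteq> 0" "v1 \<noteq> 0" "v2 \<noteq> 0"
    and ev: "M *v c = (-1) *\<^sub>R c" "M *v v1 = \<nu>1 *\<^sub>R v1" "M *v v2 = \<nu>2 *\<^sub>R v2"
    and orth: "v1 \<bullet> v2 = 0"
    and x: "x \<noteq> 0" "x \<bullet> c = 0"
  shows "x \<bullet> (M *v x) > 0"
proof -
  have pos: "\<nu>1 > 0" "\<nu>2 > 0" and sym: "transpose M = M"
    using M by (auto simp: conic_eigenvalues_def)
  have self_adjoint: "y \<bullet> (M *v z) = (M *v y) \<bullet> z" for y z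
    by (metis dot_lmul_matrix sym transpose_matrix_vector)
  have "(\<nu>1 + 1) * (c \<bullet> v1) = 0"
    using self_adjoint[of c v1] by (simp add: ev algebra_simps)
  then have c1: "c \<bullet> v1 = 0" using pos by simp
  have "(\<nu>2 + 1) * (c \<bullet> v2) = 0"
    using self_adjoint[of c v2] by (simp add: ev algebra_simps)
  then have c2: "c \<bullet> v2 = 0" using pos by simp
  have v12: "v1 \<noteq> v2" and cv: "c \<noteq> v1" "c \<noteq> v2"
    using orth c1 c2 nz by auto
  have "independent {c, v1, v2}"
    by (rule pairwise_orthogonal_independent)
       (use nz orth c1 c2 in \<open>auto simp: pairwise_def orthogonal_def inner_commute\<close>)
  moreover have "card {c, v1, v2} = 3" using v12 cv by simp
  ultimately have "dim {c, v1, v2} = DIM(real^3)"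
    by (simp add: dim_eq_card_independent)
  then have "span {c, v1, v2} = UNIV"
    by (simp only: dim_eq_full)
  then have "x \<in> span {c, v1, v2}" by simp
  then obtain k a b where "x - k *\<^sub>R c - a *\<^sub>R v1 - b *\<^sub>R v2 = 0"
    by (auto simp: span_breakdown_eq)
  then have xk: "x = k *\<^sub>R c + a *\<^sub>R v1 + b *\<^sub>R v2"
    by (simp add: algebra_simps)
  have "x \<bullet> c = k * (c \<bullet> c) + a * (c \<bullet> v1) + b * (c \<bullet> v2)"
    unfolding xk by (simp only: inner_add_left inner_scaleR_left inner_commute[of v1 c] inner_commute[of v2 c])
  then have "k = 0" using x(2) c1 c2 nz(1) by simp
  then have x': "x = a *\<^sub>R v1 + b *\<^sub>R v2" using xk by simp
  have Mx: "M *v x = (a * \<nu>1) *\<^sub>R v1 + (b * \<nu>2) *\<^sub>R v2"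
    unfolding x' by (simp add: matrix_vector_right_distrib matrix_vector_mult_scaleR ev)
  have "x \<bullet> (M *v x) = \<nu>1 * (a\<^sup>2 * (v1 \<bullet> v1)) + \<nu>2 * (b\<^sup>2 * (v2 \<bullet> v2))"
    unfolding Mx unfolding x' using orth inner_commute[of v2 v1]
    by (simp add: inner_add_left inner_add_right power2_eq_square)
  moreover have "a \<noteq> 0 \<or> b \<noteq> 0" using x(1) x' by auto
  moreover have "v1 \<bullet> v1 > 0" "v2 \<bullet> v2 > 0" using nz by simp_all
  ultimately show ?thesis
    using pos by (elim disjE) (simp_all add: add_pos_nonneg add_nonneg_pos)
qed

end

theory Submission
  imports Defs
begin

text \<open>Choose an orthonormal frame \<open>u, v, c\<close> with \<open>X\<close> and \<open>Y\<close> spanned by \<open>c, u\<close> and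
  \<open>c, v\<close>. The conics with these axes are the sets \<open>a x\<^sup>2 + b y\<^sup>2 = z\<^sup>2\<close> with \<open>a, b > 0\<close>
  (lemma \<open>conic_with_axes_iff\<close>), and such a conic encloses \<open>F\<close> iff \<open>a x\<^sup>2 + b y\<^sup>2 \<le> z\<^sup>2\<close> at each
  point of \<open>F\<close>. These inequalities are linear in \<open>(a, b)\<close>, so together with \<open>a, b \<ge> 0\<close> they
  define a closed convex set \<open>K\<close> of parameters. It is bounded because \<open>F\<close> has a point
  with \<open>x \<noteq> 0\<close> and a point with \<open>y \<noteq> 0\<close>.

  The area of the conic is a constant times the volume of the solid cone
  \<open>a x\<^sup>2 + b y\<^sup>2 < z\<^sup>2\<close> in the unit ball. Cut this cone by the lines parallel to the \<open>z\<close>-axis. The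
  line over \<open>(x, y)\<close> meets each of the two halves in a segment of length
  \<open>max 0 (sqrt (1 - x\<^sup>2 - y\<^sup>2) - sqrt (a x\<^sup>2 + b y\<^sup>2))\<close>.
  For fixed \<open>(x, y)\<close> this is a convex function of \<open>(a, b)\<close>, because the square root is
  concave; hence the area is convex, and even strictly convex
  (lemma \<open>half_cone_volume_midpoint_less\<close>). A minimum over \<open>K\<close> is therefore unique, and it exists by
  compactness and continuity.

  A minimum at a point of \<open>K\<close> with \<open>a = 0\<close> or \<open>b = 0\<close> would not belong to a conic. It is
  excluded by lemma \<open>half_cone_volume_degenerate_not_minimal\<close>: when \<open>(0, m)\<close> moves towards a
  parameter with \<open>a > 0\<close>, the integrand decreases near the line \<open>y = 0\<close> at a rate of at
  least the order \<open>1 / \<bar>y\<bar>\<close>, which is not integrable, so that the area decreases at infinite speed. By convexity the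
  segment from \<open>(0, m)\<close> to the parameter of any enclosing conic stays in \<open>K\<close>.\<close>

section \<open>The height of a solid cone over its base plane\<close>

text \<open>For \<open>a, b \<ge> 0\<close>, the length of the segment in which the line over \<open>p\<close> parallel to the third
  axis meets the part of the cone \<open>a x\<^sup>2 + b y\<^sup>2 < z\<^sup>2\<close> with \<open>z > 0\<close> in the unit ball.\<close>

definition half_chord :: "real \<Rightarrow> real \<Rightarrow> real \<times> real \<Rightarrow> real" where
  "half_chord a b p = max 0 (sqrt (1 - (fst p)\<^sup>2 - (snd p)\<^sup>2) - sqrt (a * (fst p)\<^sup>2 + b * (snd p)\<^sup>2))"

text \<open>The volume of the part of the cone \<open>a x\<^sup>2 + b y\<^sup>2 < z\<^sup>2\<close> with \<open>z > 0\<close> in the unit ball.\<close>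

definition half_cone_volume :: "real \<Rightarrow> real \<Rightarrow> real" where
  "half_cone_volume a b = (\<integral>p. half_chord a b p \<partial>lborel)"

lemma half_chord_nonneg: "0 \<le> half_chord a b p"
  by (simp add: half_chord_def)

text \<open>Outside the unit disc the first square root is at most 0, since \<^term>\<open>sqrt\<close> of a negative
  number is negative. A square in place of the disc is enough as an integrable bound, uniform in the
  parameters.\<close>

lemma half_chord_le_indicator:
  assumes "0 \<le> a" "0 \<le> b"
  shows "half_chord a b p \<le> indicator (cbox (-1, -1) (1, 1)) p"
proof (cases "(fst p)\<^sup>2 + (snd p)\<^sup>2 \<le> 1")
  case True
  then have "(fst p)\<^sup>2 \<le> 1" "(snd p)\<^sup>2 \<le> 1"
    by (smt (verit) zero_le_power2)+
  then have "\<bar>fst p\<bar> \<le> 1" "\<bar>snd p\<bar> \<le> 1"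
    by (simp_all add: abs_square_le_1)
  then have "p \<in> cbox (-1, -1) (1, 1)"
    by (cases p) (auto simp: cbox_Pair_eq abs_le_iff)
  moreover have "sqrt (1 - (fst p)\<^sup>2 - (snd p)\<^sup>2) \<le> 1"
    by (rule real_le_lsqrt) auto
  ultimately have "sqrt (1 - (fst p)\<^sup>2 - (snd p)\<^sup>2) - 0 \<le> indicator (cbox (-1, -1) (1, 1)) p"
    by simp
  moreover have "0 \<le> sqrt (a * (fst p)\<^sup>2 + b * (snd p)\<^sup>2)"
    using assms by simp
  ultimately show ?thesis unfolding half_chord_def by (intro max.boundedI indicator_pos_le) linarith
next
  case False
  then have "sqrt (1 - (fst p)\<^sup>2 - (snd p)\<^sup>2) \<le> 0" by simp
  moreover have "0 \<le> sqrt (a * (fst p)\<^sup>2 + b * (snd p)\<^sup>2)"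
    using assms by simp
  ultimately show ?thesis by (simp add: half_chord_def)
qed

lemma continuous_half_chord: "continuous_on UNIV (\<lambda>p. half_chord a b p)"
  unfolding half_chord_def by (intro continuous_intros)

lemma measurable_half_chord [measurable]: "half_chord a b \<in> borel_measurable borel"
  by (rule borel_measurable_continuous_onI) (rule continuous_half_chord)

lemma integrable_half_chord:
  assumes "0 \<le> a" "0 \<le> b"
  shows "integrable lborel (half_chord a b)"
proof (rule Bochner_Integration.integrable_bound)
  show "integrable lborel (indicator (cbox (-1, -1) (1, 1)) :: real \<times> real \<Rightarrow> real)"
    by (rule integrable_real_indicator[OF _ emeasure_lborel_cbox_finite]) simp
qed (use half_chord_le_indicator[OF assms] half_chord_nonneg in auto)

section \<open>Strict convexity and continuity in the parameters\<close>

lemma sqrt_concave: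
  assumes "0 \<le> x" "0 \<le> y" "0 \<le> s" "s \<le> 1"
  shows "(1 - s) * sqrt x + s * sqrt y \<le> sqrt ((1 - s) * x + s * y)"
proof (rule real_le_rsqrt)
  have "(1 - s) * x + s * y - ((1 - s) * sqrt x + s * sqrt y)\<^sup>2 
      = (1 - s) * (sqrt x)\<^sup>2 + s * (sqrt y)\<^sup>2 - ((1 - s) * sqrt x + s * sqrt y)\<^sup>2"
    using assms by simp
  also have "\<dots> = s * (1 - s) * (sqrt x - sqrt y)\<^sup>2"
    by (simp add: power2_eq_square algebra_simps)
  also have "\<dots> \<ge> 0" using assms by simp
  finally show "((1 - s) * sqrt x + s * sqrt y)\<^sup>2 \<le> (1 - s) * x + s * y" by simp
qed

lemma sqrt_midpoint_less:
  assumes "0 \<le> x" "0 \<le> y" "x \<noteq> y"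
  shows "(sqrt x + sqrt y) / 2 < sqrt ((x + y) / 2)"
proof (rule real_less_rsqrt)
  have "sqrt x \<noteq> sqrt y" using assms by simp
  then have "0 < (sqrt x - sqrt y)\<^sup>2" by simp
  then have "(sqrt x + sqrt y)\<^sup>2 < 2 * ((sqrt x)\<^sup>2 + (sqrt y)\<^sup>2)"
    by (simp add: power2_eq_square algebra_simps)
  then show "((sqrt x + sqrt y) / 2)\<^sup>2 < (x + y) / 2"
    using assms by (simp add: power_divide)
qed

lemma half_chord_convex:
  assumes "0 \<le> a" "0 \<le> b" "0 \<le> a'" "0 \<le> b'" "0 \<le> s" "s \<le> 1"
  shows "half_chord ((1 - s) * a + s * a') ((1 - s) * b + s * b') p
      \<le> (1 - s) * half_chord a b p + s * half_chord a' b' p"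
proof -
  define A where "A = sqrt (1 - (fst p)\<^sup>2 - (snd p)\<^sup>2)"
  define q where "q = a * (fst p)\<^sup>2 + b * (snd p)\<^sup>2"
  define q' where "q' = a' * (fst p)\<^sup>2 + b' * (snd p)\<^sup>2"
  have *: "((1 - s) * a + s * a') * (fst p)\<^sup>2 + ((1 - s) * b + s * b') * (snd p)\<^sup>2 = (1 - s) * q + s * q'"
    unfolding q_def q'_def by algebra
  have "(1 - s) * sqrt q + s * sqrt q' \<le> sqrt ((1 - s) * q + s * q')"
    by (rule sqrt_concave) (use assms in \<open>auto simp: q_def q'_def\<close>)
  then have "A - sqrt ((1 - s) * q + s * q') \<le> (1 - s) * (A - sqrt q) + s * (A - sqrt q')"
    by (simp add: algebra_simps)
  also have "\<dots> \<le> (1 - s) * max 0 (A - sqrt q) + s * max 0 (A - sqrt q')"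
    using assms by (intro add_mono mult_left_mono) auto
  finally have "A - sqrt ((1 - s) * q + s * q') \<le> (1 - s) * max 0 (A - sqrt q) + s * max 0 (A - sqrt q')" .
  moreover have "0 \<le> (1 - s) * max 0 (A - sqrt q) + s * max 0 (A - sqrt q')"
    using assms by simp
  ultimately show ?thesis
    unfolding half_chord_def * A_def[symmetric] q_def[symmetric] q'_def[symmetric] by simp
qed

text \<open>Where both chords have positive length the maximum drops out on the right, and the strict
  concavity of the square root decides.\<close>

lemma half_chord_midpoint_less:
  assumes nn: "0 \<le> a" "0 \<le> b" "0 \<le> a'" "0 \<le> b'"
    and q: "a * (fst p)\<^sup>2 + b * (snd p)\<^sup>2 \<noteq> a' * (fst p)\<^sup>2 + b' * (snd p)\<^sup>2"
    and pos: "0 < half_chord a b p" "0 < half_chord a' b' p"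
  shows "half_chord ((a + a') / 2) ((b + b') / 2) p < (half_chord a b p + half_chord a' b' p) / 2"
proof -
  define A where "A = sqrt (1 - (fst p)\<^sup>2 - (snd p)\<^sup>2)"
  define q where "q = a * (fst p)\<^sup>2 + b * (snd p)\<^sup>2"
  define q' where "q' = a' * (fst p)\<^sup>2 + b' * (snd p)\<^sup>2"
  have *: "((a + a') / 2) * (fst p)\<^sup>2 + ((b + b') / 2) * (snd p)\<^sup>2 = (q + q') / 2"
    unfolding q_def q'_def by (simp add: field_simps)
  have "(sqrt q + sqrt q') / 2 < sqrt ((q + q') / 2)"
    by (rule sqrt_midpoint_less) (use assms in \<open>auto simp: q_def q'_def\<close>)
  then show ?thesis
    using pos unfolding half_chord_def * A_def[symmetric] q_def[symmetric] q'_def[symmetric]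
    by (auto simp: max_def split: if_splits)
qed

text \<open>Close to the origin every chord is nondegenerate. Points on the two coordinate axes are
  enough to tell two different parameters apart.\<close>

lemma half_chord_pos_on_axes:
  assumes "0 \<le> a" "0 \<le> b" "s\<^sup>2 * (1 + a + b) < 1"
  shows "0 < half_chord a b (s, 0)" "0 < half_chord a b (0, s)"
proof -
  have "0 \<le> a * s\<^sup>2" "0 \<le> b * s\<^sup>2" using assms by simp_all
  then have "a * s\<^sup>2 < 1 - s\<^sup>2" "b * s\<^sup>2 < 1 - s\<^sup>2"
    using assms(3) by (simp_all add: algebra_simps)
  then show "0 < half_chord a b (s, 0)" "0 < half_chord a b (0, s)"
    by (simp_all add: half_chord_def)
qed

text \<open>The convexity defect of the integrand is nonnegative and continuous, and it is positive at
  some point near the origin; so its integral is positive.\<close>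

lemma half_cone_volume_midpoint_less:
  assumes nn: "0 \<le> a" "0 \<le> b" "0 \<le> a'" "0 \<le> b'" and ne: "(a, b) \<noteq> (a', b')"
  shows "half_cone_volume ((a + a') / 2) ((b + b') / 2)
      < (half_cone_volume a b + half_cone_volume a' b') / 2"
proof -
  define D where "D p = (half_chord a b p + half_chord a' b' p) / 2 
      - half_chord ((a + a') / 2) ((b + b') / 2) p" for p
  have D_nonneg: "0 \<le> D p" for p
    using half_chord_convex[OF nn, of "1/2" p] by (simp add: D_def field_simps)
  have ints: "integrable lborel (half_chord a b)" "integrable lborel (half_chord a' b')"
    "integrable lborel (half_chord ((a + a') / 2) ((b + b') / 2))"
    using nn by (auto intro: integrable_half_chord)
  then have D_int: "integrable lborel D" unfolding D_def by auto
  have int_D: "integral\<^sup>L lborel D = (half_cone_volume a b + half_cone_volume a' b') / 2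
      - half_cone_volume ((a + a') / 2) ((b + b') / 2)"
    unfolding D_def half_cone_volume_def using ints by simp
  have D_cont: "continuous_on UNIV D"
    unfolding D_def by (intro continuous_intros continuous_half_chord) auto
  define s where "s = 1 / (2 + (a + b) + (a' + b'))"
  have s: "0 < s" "s\<^sup>2 * (1 + a + b) < 1" "s\<^sup>2 * (1 + a' + b') < 1"
  proof -
    have N: "1 \<le> 2 + (a + b) + (a' + b')" using nn by simp
    then show "0 < s" by (simp add: s_def)
    have "2 + (a + b) + (a' + b') \<le> (2 + (a + b) + (a' + b'))\<^sup>2"
      using N by (simp add: self_le_power)
    then have "1 + a + b < (2 + (a + b) + (a' + b'))\<^sup>2" "1 + a' + b' < (2 + (a + b) + (a' + b'))\<^sup>2"
      using nn by linarith+
    then show "s\<^sup>2 * (1 + a + b) < 1" "s\<^sup>2 * (1 + a' + b') < 1"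
      using N by (simp_all add: s_def power_divide)
  qed
  have "\<exists>p. 0 < D p"
  proof (cases "a = a'")
    case False
    have "0 < D (s, 0)"
      unfolding D_def using half_chord_midpoint_less[OF nn, of "(s, 0)"] False s
        half_chord_pos_on_axes(1)[OF nn(1,2) s(2)] half_chord_pos_on_axes(1)[OF nn(3,4) s(3)] by simp
    then show ?thesis by blast
  next
    case True
    then have "b \<noteq> b'" using ne by simp
    then have "0 < D (0, s)"
      unfolding D_def using half_chord_midpoint_less[OF nn, of "(0, s)"] s
        half_chord_pos_on_axes(2)[OF nn(1,2) s(2)] half_chord_pos_on_axes(2)[OF nn(3,4) s(3)] by simp
    then show ?thesis by blast
  qed
  moreover have "open {p. 0 < D p}"
    using D_cont by (intro open_Collect_less continuous_intros)
  ultimately have "{p. 0 < D p} \<notin> null_sets lborel"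
    by (metis (mono_tags) mem_Collect_eq empty_iff open_not_negligible negligible_iff_null_sets null_sets_completionI)
  moreover have "{p. 0 < D p} \<in> sets lborel"
    using \<open>open {p. 0 < D p}\<close> by simp
  ultimately have "\<not> (AE p in lborel. \<not> 0 < D p)"
    using AE_iff_null_sets[of "{p. 0 < D p}" lborel] by simp
  then have "\<not> (AE p in lborel. D p = 0)"
    by (rule contrapos_nn) (erule eventually_mono, simp)
  then have "integral\<^sup>L lborel D \<noteq> 0"
    using integral_nonneg_eq_0_iff_AE[OF D_int] D_nonneg by simp
  moreover have "0 \<le> integral\<^sup>L lborel D" using D_nonneg by simp
  ultimately show ?thesis unfolding int_D by simp
qed

lemma continuous_half_cone_volume:
  "continuous_on ({0..} \<times> {0..}) (\<lambda>(a, b). half_cone_volume a b)"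
  unfolding continuous_on_sequentially
proof (intro allI ballI impI)
  fix x :: "nat \<Rightarrow> real \<times> real" and l
  assume l: "l \<in> {0..} \<times> {0..}" and x: "(\<forall>n. x n \<in> {0..} \<times> {0..}) \<and> x \<longlonglongrightarrow> l"
  have nn: "0 \<le> fst (x n)" "0 \<le> snd (x n)" for n using x by (auto simp: mem_Times_iff)
  have "(\<lambda>n. half_cone_volume (fst (x n)) (snd (x n))) \<longlonglongrightarrow> half_cone_volume (fst l) (snd l)"
    unfolding half_cone_volume_def
  proof (rule integral_dominated_convergence)
    show "integrable lborel (indicator (cbox (-1, -1) (1, 1)) :: real \<times> real \<Rightarrow> real)"
      by (rule integrable_real_indicator[OF _ emeasure_lborel_cbox_finite]) simp
    show "AE p in lborel. (\<lambda>n. half_chord (fst (x n)) (snd (x n)) p) \<longlonglongrightarrow> half_chord (fst l) (snd l) p"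
      unfolding half_chord_def using x by (intro AE_I2) (auto intro!: tendsto_intros)
  qed (use half_chord_le_indicator[OF nn] half_chord_nonneg in auto)
  then show "((\<lambda>(a, b). half_cone_volume a b) \<circ> x) \<longlonglongrightarrow> (case l of (a, b) \<Rightarrow> half_cone_volume a b)"
    by (simp add: comp_def case_prod_beta)
qed

section \<open>Degenerate cones are not minimal\<close>

lemma half_cone_volume_commute: "half_cone_volume a b = half_cone_volume b a"
proof -
  have "half_cone_volume a b = integral\<^sup>L (lborel \<Otimes>\<^sub>M lborel) (half_chord a b)"
    by (simp add: half_cone_volume_def lborel_prod)
  also have "\<dots> = integral\<^sup>L (lborel \<Otimes>\<^sub>M lborel) (\<lambda>(x, y). half_chord a b (y, x))"
    by (rule lborel_pair.integral_product_swap[symmetric]) (simp add: lborel_prod)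
  also have "(\<lambda>(x, y). half_chord a b (y, x)) = half_chord b a"
    by (auto simp: half_chord_def algebra_simps)
  finally show ?thesis by (simp add: half_cone_volume_def lborel_prod)
qed

text \<open>The difference of the two chords is
  \<open>sqrt q' - sqrt q = (q' - q) / (sqrt q' + sqrt q)\<close>, where \<open>q\<close> and \<open>q'\<close> are the
  quadratic forms at the two parameters. For small \<open>y\<close> the numerator is at least a constant times
  \<open>t\<close>. The denominator is of the order of \<open>y\<close> because \<open>t\<close> is small in comparison with
  \<open>y\<^sup>2\<close>. Hence the gain per unit of \<open>t\<close> is of the order of \<open>1 / y\<close>, with a constant that does
  not depend on \<open>t\<close>.\<close>

lemma half_chord_gain:
  assumes m: "0 \<le> m" and a: "0 < a" and b: "0 \<le> b" and t: "0 \<le> t" "t \<le> 1"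
    and K: "K = sqrt (m + b + 1)"
    and x: "1/4 \<le> x" "x \<le> 1/2" and y: "0 < y" "K * y \<le> 1/2" "32 * m * y\<^sup>2 \<le> a" "t * a \<le> y\<^sup>2"
  shows "t * (a / (64 * K) / y) \<le> half_chord 0 m (x, y) - half_chord (t * a) ((1 - t) * m + t * b) (x, y)"
proof -
  define q where "q = m * y\<^sup>2"
  define q' where "q' = t * a * x\<^sup>2 + ((1 - t) * m + t * b) * y\<^sup>2"
  define A where "A = sqrt (1 - x\<^sup>2 - y\<^sup>2)"
  have K1: "1 \<le> K" using m b by (simp add: K)
  have K2: "K\<^sup>2 = m + b + 1" using m b by (simp add: K)
  have q0: "0 \<le> q" using m by (simp add: q_def)
  have q'0: "0 \<le> q'" using m a b t by (auto simp: q'_def)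
  have "y \<le> K * y" using K1 y(1) by simp
  then have y2: "y \<le> 1/2" using y(2) by simp
  have xsq: "x\<^sup>2 \<le> 1/4" using power_mono[of x "1/2" 2] x by (simp add: power2_eq_square)
  have xsq': "1/16 \<le> x\<^sup>2" using power_mono[of "1/4" x 2] x by (simp add: power2_eq_square)
  have ysq: "y\<^sup>2 \<le> 1/4" using power_mono[of y "1/2" 2] y y2 by (simp add: power2_eq_square)
  have A: "1/2 \<le> A" unfolding A_def by (rule real_le_rsqrt) (use xsq ysq in \<open>simp add: power2_eq_square\<close>)
  have "q \<le> (K * y)\<^sup>2"
    unfolding q_def power_mult_distrib K2 using b by (intro mult_right_mono) auto
  then have sq: "sqrt q \<le> K * y" using K1 y by (intro real_le_lsqrt) auto
  have "t * a * x\<^sup>2 \<le> t * a * 1"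
    using xsq a t by (intro mult_left_mono) auto
  then have 1: "t * a * x\<^sup>2 \<le> 1 * y\<^sup>2" using y(4) by simp
  have "(1 - t) * m + t * b \<le> m + b"
    using m b t mult_left_le_one_le[of m "1 - t"] mult_left_le_one_le[of b t] by simp
  then have "((1 - t) * m + t * b) * y\<^sup>2 \<le> (m + b) * y\<^sup>2" by (intro mult_right_mono) auto
  then have "q' \<le> (K * y)\<^sup>2"
    unfolding q'_def power_mult_distrib K2 using 1 by (simp add: algebra_simps)
  then have sq': "sqrt q' \<le> K * y" using K1 y by (intro real_le_lsqrt) auto
  have "t * (a / 32) \<le> t * (a * x\<^sup>2 - m * y\<^sup>2)"
    using y(3) a mult_left_mono[OF xsq', of a] t by (intro mult_left_mono) linarith+
  also have "\<dots> \<le> q' - q"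
    unfolding q'_def q_def using t b by (simp add: algebra_simps)
  also have "\<dots> = (sqrt q' - sqrt q) * (sqrt q' + sqrt q)"
    using q0 q'0 by (simp add: algebra_simps)
  finally have 2: "t * (a / 32) \<le> (sqrt q' - sqrt q) * (sqrt q' + sqrt q)" .
  have Ky: "0 < K * y" using K1 y by simp
  have ge: "sqrt q \<le> sqrt q'"
  proof -
    have "0 \<le> t * (a / 32)" using t a by simp
    with \<open>t * (a / 32) \<le> t * (a * x\<^sup>2 - m * y\<^sup>2)\<close> \<open>t * (a * x\<^sup>2 - m * y\<^sup>2) \<le> q' - q\<close> show ?thesis by simp
  qed
  have "(sqrt q' - sqrt q) * (sqrt q' + sqrt q) \<le> (sqrt q' - sqrt q) * (2 * (K * y))"
    using ge sq sq' by (intro mult_left_mono) auto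
  with 2 have "t * (a / 32) / (2 * (K * y)) \<le> sqrt q' - sqrt q"
    using Ky by (simp add: pos_divide_le_eq)
  then have "t * (a / (64 * K) / y) \<le> sqrt q' - sqrt q" by (simp add: mult.assoc)
  moreover have "half_chord 0 m (x, y) = A - sqrt q"
    unfolding half_chord_def using sq y(2) A by (simp add: A_def q_def)
  moreover have "half_chord (t * a) ((1 - t) * m + t * b) (x, y) = A - sqrt q'"
    unfolding half_chord_def using sq' y(2) A by (simp add: A_def q'_def)
  ultimately show ?thesis by simp
qed

lemma integral_inverse_snd:
  assumes "0 < e" "e \<le> d" "l \<le> u"
  shows "integrable lborel (\<lambda>p. indicator (cbox (l, e) (u, d)) p * (1 / snd p) :: real)" (is ?int)
    and "(\<integral>p. indicator (cbox (l, e) (u, d)) p * (1 / snd p) \<partial>lborel) = (u - l) * (ln d - ln e)" (is ?eq)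
proof -
  have "integrable lborel (\<lambda>p. indicator (cbox (l, e) (u, d)) p *\<^sub>R (1 / snd p))"
    by (rule borel_integrable_compact) (use assms in \<open>auto intro!: continuous_intros simp: cbox_Pair_eq compact_Times\<close>)
  then show int: ?int by simp
  have "(\<integral>p. indicator (cbox (l, e) (u, d)) p * (1 / snd p) \<partial>lborel)
    = (\<integral>x. (\<integral>y. indicator (cbox (l, e) (u, d)) (x, y) * (1 / snd (x, y)) \<partial>lborel) \<partial>lborel)"
    using lborel_pair.integral_fst'[of "\<lambda>p. indicator (cbox (l, e) (u, d)) p * (1 / snd p)"] int
    by (simp add: lborel_prod)
  also have "\<dots> = (\<integral>x. indicator {l..u} x * (\<integral>y. (1 / y) * indicator {e..d} y \<partial>lborel) \<partial>lborel)"
    by (intro Bochner_Integration.integral_cong refl)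
       (auto simp: cbox_Pair_eq indicator_def if_distrib cong: if_cong)
  also have "(\<integral>y. (1 / y) * indicator {e..d} y \<partial>lborel) = ln d - ln e"
    by (rule integral_FTC_Icc_real) (use assms in \<open>auto intro!: derivative_eq_intros continuous_intros\<close>)
  finally show ?eq using assms by simp
qed

text \<open>On a rectangle that approaches the line \<open>y = 0\<close> up to the distance \<open>e\<close>, the gain is at
  least \<open>t k / y\<close>; its integral is \<open>t k / 4\<close> times \<open>ln (d / e)\<close>. Elsewhere the loss is at most
  \<open>t\<close> by convexity, which costs at most \<open>4 t\<close> in total. The logarithm exceeds any bound
  when \<open>e\<close> is small, and \<open>t\<close> is chosen after \<open>e\<close>.\<close>

lemma half_cone_volume_degenerate_not_minimal:
  assumes m: "0 \<le> m" and a: "0 < a" and b: "0 \<le> b"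
  shows "\<exists>t. 0 < t \<and> t \<le> 1 \<and> half_cone_volume (t * a) ((1 - t) * m + t * b) < half_cone_volume 0 m"
proof -
  define K where "K = sqrt (m + b + 1)"
  have K1: "1 \<le> K" using m b by (simp add: K_def)
  define k where "k = a / (64 * K)"
  have k: "0 < k" using a K1 by (simp add: k_def)
  define d where "d = min (1 / (2 * K)) (sqrt (a / (32 * (m + 1))))"
  have d: "0 < d" using a m K1 by (simp add: d_def)
  have dK: "K * d \<le> 1/2" 
    using mult_left_mono[of d "1 / (2 * K)" K] K1 by (simp add: d_def)
  have "d\<^sup>2 \<le> (sqrt (a / (32 * (m + 1))))\<^sup>2"
    using d by (intro power_mono) (auto simp: d_def)
  then have "d\<^sup>2 \<le> a / (32 * (m + 1))" using a m by simp
  then have "32 * (m + 1) * d\<^sup>2 \<le> a" using m by (simp add: pos_le_divide_eq mult.commute)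
  then have dm: "32 * m * d\<^sup>2 \<le> a" 
    by (smt (verit) mult_right_mono zero_le_power2 m)
  \<comment> \<open>Any value above \<open>16 / k\<close> would do: the gain \<open>k L / 4\<close> has to exceed 4, the area of the
    square \<open>B\<close> on which the loss is counted.\<close>
  define L where "L = 17 / k"
  have L: "0 < L" using k by (simp add: L_def)
  define e where "e = d * exp (- L)"
  have e: "0 < e" "e \<le> d" using d L by (auto simp: e_def)
  have ln_e: "ln d - ln e = L" using d by (simp add: e_def ln_mult)
  define t where "t = min 1 (e\<^sup>2 / a)"
  have t: "0 < t" "t \<le> 1" using e a by (auto simp: t_def)
  have ta: "t * a \<le> e\<^sup>2" using mult_right_mono[of t "e\<^sup>2 / a" a] a by (simp add: t_def)
  define G where "G p = half_chord 0 m p - half_chord (t * a) ((1 - t) * m + t * b) p" for p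
  define B :: "(real \<times> real) set" where "B = cbox (-1, -1) (1, 1)"
  define R :: "(real \<times> real) set" where "R = cbox (1/4, e) (1/2, d)"
  have on_R: "t * (k * (1 / snd p)) \<le> G p" if "p \<in> R" for p
  proof -
    have p: "1/4 \<le> fst p" "fst p \<le> 1/2" "e \<le> snd p" "snd p \<le> d"
      using that by (cases p; auto simp: R_def cbox_Pair_eq)+
    have "K * snd p \<le> 1/2" using p K1 dK mult_left_mono[of "snd p" d K] by linarith
    moreover have sq: "(snd p)\<^sup>2 \<le> d\<^sup>2" using p e by (intro power_mono) auto
    have "32 * m * (snd p)\<^sup>2 \<le> a" using dm mult_left_mono[OF sq, of "32 * m"] m by simp
    moreover have "e\<^sup>2 \<le> (snd p)\<^sup>2" using p e by (intro power_mono) auto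
    then have "t * a \<le> (snd p)\<^sup>2" using ta by simp
    ultimately show ?thesis
      using half_chord_gain[OF m a b, of t K "fst p" "snd p"] t p e
      by (simp add: G_def K_def k_def)
  qed
  have on_B: "- t * indicator B p \<le> G p" for p
  proof -
    have "half_chord ((1 - t) * 0 + t * a) ((1 - t) * m + t * b) p
        \<le> (1 - t) * half_chord 0 m p + t * half_chord a b p"
      using assms t by (intro half_chord_convex) auto
    then have "t * (half_chord 0 m p - half_chord a b p) \<le> G p"
      by (simp add: G_def algebra_simps)
    moreover have "t * - indicator B p \<le> t * (half_chord 0 m p - half_chord a b p)"
      using half_chord_le_indicator[of a b p] half_chord_nonneg[of 0 m p] assms t
      by (intro mult_left_mono) (auto simp: B_def)
    ultimately show ?thesis by simp
  qed
  have ints: "integrable lborel (half_chord 0 m)"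
    "integrable lborel (half_chord (t * a) ((1 - t) * m + t * b))"
    using assms t by (auto intro!: integrable_half_chord)
  have int_R: "integrable lborel (\<lambda>p. indicator R p * (1 / snd p))"
    "(\<integral>p. indicator R p * (1 / snd p) \<partial>lborel) = L / 4"
    using integral_inverse_snd[OF e, of "1/4" "1/2"] by (simp_all add: R_def ln_e)
  have int_B: "integrable lborel (indicator B :: real \<times> real \<Rightarrow> real)"
    unfolding B_def by (rule integrable_real_indicator[OF _ emeasure_lborel_cbox_finite]) simp
  have "measure lborel B = 4"
    by (simp add: B_def content_Pair)
  then have "(\<integral>p. indicator B p \<partial>lborel) = (4 :: real)"
    by simp
  moreover have "(\<integral>p. t * (k * (indicator R p * (1 / snd p)) - indicator B p) \<partial>lborel)
      = t * (k * (\<integral>p. indicator R p * (1 / snd p) \<partial>lborel) - (\<integral>p. indicator B p \<partial>lborel))"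
    using int_R(1) int_B
    by (subst integral_mult_right_zero, subst Bochner_Integration.integral_diff) (simp_all only: integral_mult_right_zero integrable_mult_right)
  ultimately have "(\<integral>p. t * (k * (indicator R p * (1 / snd p)) - indicator B p) \<partial>lborel) = t * (k * (L / 4) - 4)"
    using int_R(2) by metis
  also have "k * (L / 4) - 4 = 1/4" using k by (simp add: L_def)
  finally have eq: "(\<integral>p. t * (k * (indicator R p * (1 / snd p)) - indicator B p) \<partial>lborel) = t / 4" by simp
  have "t * (k * (indicator R p * (1 / snd p)) - indicator B p) \<le> G p" for p
  proof (cases "p \<in> R")
    case True
    moreover have "0 \<le> t * indicator B p" using t by simp
    ultimately show ?thesis using on_R[OF True] by (simp add: algebra_simps)
  qed (use on_B[of p] in simp)
  then have "(\<integral>p. t * (k * (indicator R p * (1 / snd p)) - indicator B p) \<partial>lborel) \<le> (\<integral>p. G p \<partial>lborel)"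
    unfolding G_def
    by (intro integral_mono integrable_mult_right Bochner_Integration.integrable_diff int_R(1) int_B ints)
  then have "t / 4 \<le> half_cone_volume 0 m - half_cone_volume (t * a) ((1 - t) * m + t * b)"
    unfolding eq using ints by (simp add: G_def half_cone_volume_def)
  then show ?thesis using t by (intro exI[of _ t]) auto
qed


text \<open>A minimal parameter on the boundary of the quadrant could be improved along the segment
  towards \<open>(a1, b1)\<close>, and two minimal parameters could be improved at their midpoint.\<close>

lemma half_cone_volume_unique_minimum:
  assumes K: "compact K" "convex K" "K \<subseteq> {0..} \<times> {0..}"
    and pos: "(a1, b1) \<in> K" "0 < a1" "0 < b1"
  obtains a b where "(a, b) \<in> K" "0 < a" "0 < b"
    and "\<And>a' b'. (a', b') \<in> K \<Longrightarrow> (a', b') \<noteq> (a, b) \<Longrightarrow> half_cone_volume a b < half_cone_volume a' b'"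
proof -
  have "continuous_on K (\<lambda>(a, b). half_cone_volume a b)"
    using continuous_half_cone_volume K(3) by (rule continuous_on_subset)
  then obtain z where z: "z \<in> K" "\<And>w. w \<in> K \<Longrightarrow> (\<lambda>(a, b). half_cone_volume a b) z \<le> (\<lambda>(a, b). half_cone_volume a b) w"
    using continuous_attains_inf[of K "\<lambda>(a, b). half_cone_volume a b"] K(1) pos(1) by blast
  obtain a b where zab: "z = (a, b)" by (cases z)
  have ab: "(a, b) \<in> K" and le: "(a', b') \<in> K \<Longrightarrow> half_cone_volume a b \<le> half_cone_volume a' b'" for a' b'
    using z zab by auto
  have nn: "0 \<le> a" "0 \<le> b" using ab K(3) by auto
  have segment: "((1 - t) * a + t * a1, (1 - t) * b + t * b1) \<in> K" if "0 < t" "t \<le> 1" for t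
    using convexD_alt[OF K(2) ab pos(1), of t] that by simp
  have "a \<noteq> 0"
  proof
    assume a: "a = 0"
    obtain t where t: "0 < t" "t \<le> 1" "half_cone_volume (t * a1) ((1 - t) * b + t * b1) < half_cone_volume 0 b"
      using half_cone_volume_degenerate_not_minimal[of b a1 b1] nn pos by auto
    then show False using le[OF segment[OF t(1,2)]] a by simp
  qed
  moreover have "b \<noteq> 0"
  proof
    assume b: "b = 0"
    obtain t where t: "0 < t" "t \<le> 1" "half_cone_volume (t * b1) ((1 - t) * a + t * a1) < half_cone_volume 0 a"
      using half_cone_volume_degenerate_not_minimal[of a b1 a1] nn pos by auto
    then show False
      using le[OF segment[OF t(1,2)]] b by (simp add: half_cone_volume_commute)
  qed
  moreover have "half_cone_volume a b < half_cone_volume a' b'" if K': "(a', b') \<in> K" and ne: "(a', b') \<noteq> (a, b)" for a' b'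
  proof -
    have "((a + a') / 2, (b + b') / 2) \<in> K"
      using convexD_alt[OF K(2) ab K', of "1/2"] by (simp add: field_simps)
    then have "half_cone_volume a b \<le> half_cone_volume ((a + a') / 2) ((b + b') / 2)" by (rule le)
    also have "\<dots> < (half_cone_volume a b + half_cone_volume a' b') / 2"
      by (rule half_cone_volume_midpoint_less) (use nn K' K(3) ne in auto)
    finally show ?thesis by simp
  qed
  ultimately show ?thesis using that ab nn by auto
qed

section \<open>The volume of the cone by slicing\<close>

lemma continuous_vector_3:
  assumes "continuous_on S f" "continuous_on S g" "continuous_on S h"
  shows "continuous_on S (\<lambda>p. vector [f p, g p, h p] :: real^3)"
proof -
  have "(\<lambda>p. vector [f p, g p, h p] :: real^3) = (\<lambda>p. \<chi> i. if i = 1 then f p else if i = 2 then g p else h p)"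
    by (rule ext) (simp add: vec_eq_iff forall_3)
  moreover have "continuous_on S (\<lambda>p. (\<chi> i. if i = 1 then f p else if i = 2 then g p else h p) :: real^3)"
  proof (rule continuous_on_vec_lambda)
    fix i :: 3
    show "continuous_on S (\<lambda>p. if i = 1 then f p else if i = 2 then g p else h p)"
      using assms by (cases "i = 1"; cases "i = 2") auto
  qed
  ultimately show ?thesis by (simp only:)
qed

lemma measurable_vector_3 [measurable]:
  "(\<lambda>((x, y), z). vector [x, y, z] :: real^3) \<in> borel_measurable borel"
  unfolding case_prod_beta
  by (intro borel_measurable_continuous_onI continuous_vector_3 continuous_intros)

text \<open>Fubini's theorem speaks of product measures; this carries it over to vectors with three
  components.\<close>

lemma lborel_vector_3:
  "lborel = distr (lborel :: ((real \<times> real) \<times> real) measure) borel (\<lambda>((x, y), z). vector [x, y, z] :: real^3)"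
proof (rule lborel_eqI)
  fix l u :: "real^3"
  assume lu: "\<And>b. b \<in> Basis \<Longrightarrow> l \<bullet> b \<le> u \<bullet> b"
  then have lui: "l $ i \<le> u $ i" for i
    by (metis axis_in_Basis_iff cart_eq_inner_axis inner_real_def mult.right_neutral Basis_real_def singletonI)
  have prod3: "(\<Prod>i\<in>UNIV. f i) = f 1 * f 2 * f 3" for f :: "3 \<Rightarrow> real"
    unfolding UNIV_3 by simp
  have "(\<lambda>((x, y), z). vector [x, y, z]) -` box l u = (box (l$1) (u$1) \<times> box (l$2) (u$2)) \<times> box (l$3) (u$3)"
    by (auto simp: mem_box_cart forall_3)
  then have "emeasure (distr (lborel :: ((real \<times> real) \<times> real) measure) borel (\<lambda>((x, y), z). vector [x, y, z])) (box l u)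
    = emeasure (lborel \<Otimes>\<^sub>M lborel) ((box (l$1) (u$1) \<times> box (l$2) (u$2)) \<times> box (l$3) (u$3))"
    by (subst emeasure_distr) (simp_all add: lborel_prod)
  also have "\<dots> = emeasure (lborel \<Otimes>\<^sub>M lborel) (box (l$1) (u$1) \<times> box (l$2) (u$2)) * emeasure lborel (box (l$3) (u$3))"
    by (subst lborel.emeasure_pair_measure_Times) (auto simp: lborel_prod intro!: borel_open open_Times)
  also have "\<dots> = ennreal (u$1 - l$1) * ennreal (u$2 - l$2) * ennreal (u$3 - l$3)"
    using lui by (subst lborel.emeasure_pair_measure_Times) auto
  also have "\<dots> = ennreal (\<Prod>i\<in>UNIV. u$i - l$i)"
    unfolding prod3 using lui by (simp add: ennreal_mult)
  also have "(\<Prod>i\<in>UNIV. u$i - l$i) = (\<Prod>b\<in>Basis. (u - l) \<bullet> b)"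
  proof -
    have "cbox l u \<noteq> {}" using lu by (simp add: box_ne_empty)
    from content_cbox_cart[OF this] content_cbox'[OF this] show ?thesis
      by (simp only: inner_diff_left)
  qed
  finally show "emeasure (distr (lborel :: ((real \<times> real) \<times> real) measure) borel (\<lambda>((x, y), z). vector [x, y, z])) (box l u)
      = ennreal (\<Prod>b\<in>Basis. (u - l) \<bullet> b)" .
qed simp

lemma emeasure_chord:
  assumes "0 \<le> a" "0 \<le> b"
  shows "emeasure lborel {z. (fst p)\<^sup>2 + (snd p)\<^sup>2 + z\<^sup>2 \<le> 1 \<and> a * (fst p)\<^sup>2 + b * (snd p)\<^sup>2 < z\<^sup>2}
    = ennreal (2 * half_chord a b p)"
proof -
  define r where "r = 1 - (fst p)\<^sup>2 - (snd p)\<^sup>2"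
  define q where "q = a * (fst p)\<^sup>2 + b * (snd p)\<^sup>2"
  have q: "0 \<le> q" using assms by (simp add: q_def)
  have hc: "half_chord a b p = max 0 (sqrt r - sqrt q)" by (simp add: half_chord_def r_def q_def)
  have mem: "z\<^sup>2 \<le> r \<and> q < z\<^sup>2 \<longleftrightarrow> sqrt q < \<bar>z\<bar> \<and> \<bar>z\<bar> \<le> sqrt r" for z
  proof -
    have "z\<^sup>2 \<le> r \<longleftrightarrow> \<bar>z\<bar> \<le> sqrt r"
      by (metis real_sqrt_abs real_sqrt_le_iff)
    moreover have "q < z\<^sup>2 \<longleftrightarrow> sqrt q < \<bar>z\<bar>"
      by (metis real_sqrt_abs real_sqrt_less_iff)
    ultimately show ?thesis by blast
  qed
  have "{z. (fst p)\<^sup>2 + (snd p)\<^sup>2 + z\<^sup>2 \<le> 1 \<and> a * (fst p)\<^sup>2 + b * (snd p)\<^sup>2 < z\<^sup>2} = {z. z\<^sup>2 \<le> r \<and> q < z\<^sup>2}"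
    by (auto simp: r_def q_def)
  also have "\<dots> = {- sqrt r ..< - sqrt q} \<union> {sqrt q <.. sqrt r}"
    using q by (auto simp: mem abs_if split: if_splits)
       (smt (verit) real_sqrt_ge_zero)+
  also have "emeasure lborel \<dots> = emeasure lborel {- sqrt r ..< - sqrt q} + emeasure lborel {sqrt q <.. sqrt r}"
    using q by (intro plus_emeasure[symmetric]) (auto, smt (verit) real_sqrt_ge_zero)
  also have "\<dots> = ennreal (2 * half_chord a b p)"
  proof (cases "sqrt q \<le> sqrt r")
    case True
    then show ?thesis unfolding hc by (simp add: ennreal_plus[symmetric] del: ennreal_plus)
  next
    case False
    then have "{- sqrt r ..< - sqrt q} = {}" "{sqrt q <.. sqrt r} = {}" by auto
    then show ?thesis unfolding hc using False by simp
  qed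
  finally show ?thesis .
qed

lemma cone_in_borel: "{w::real^3. norm w \<le> 1 \<and> a * (w$1)\<^sup>2 + b * (w$2)\<^sup>2 < (w$3)\<^sup>2} \<in> sets borel"
proof -
  have "{w::real^3. norm w \<le> 1 \<and> a * (w$1)\<^sup>2 + b * (w$2)\<^sup>2 < (w$3)\<^sup>2}
      = {w. norm w \<le> 1} \<inter> {w. a * (w$1)\<^sup>2 + b * (w$2)\<^sup>2 < (w$3)\<^sup>2}" by auto
  moreover have "closed {w::real^3. norm w \<le> 1}"
    by (intro closed_Collect_le continuous_intros)
  moreover have "open {w::real^3. a * (w$1)\<^sup>2 + b * (w$2)\<^sup>2 < (w$3)\<^sup>2}"
    by (intro open_Collect_less continuous_intros)
  ultimately show ?thesis by (auto intro: borel_open borel_closed)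
qed

lemma measure_cone:
  assumes "0 \<le> a" "0 \<le> b"
  shows "measure lebesgue {w::real^3. norm w \<le> 1 \<and> a * (w$1)\<^sup>2 + b * (w$2)\<^sup>2 < (w$3)\<^sup>2} = 2 * half_cone_volume a b"
    (is "measure lebesgue ?E = _")
proof -
  let ?g = "\<lambda>((x, y), z). vector [x, y, z] :: real^3"
  have E: "?E \<in> sets borel" by (rule cone_in_borel)
  have E': "?g -` ?E \<in> sets (lborel \<Otimes>\<^sub>M lborel)"
    using measurable_sets[OF measurable_vector_3 E] by (simp only: lborel_prod sets_lborel space_borel Int_UNIV_right)
  have norm3: "norm (vector [x, y, z] :: real^3) \<le> 1 \<longleftrightarrow> x\<^sup>2 + y\<^sup>2 + z\<^sup>2 \<le> 1" for x y z
    by (simp add: norm_eq_sqrt_inner inner_vec_def sum_3 power2_eq_square)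
  have "emeasure lborel ?E = emeasure (lborel \<Otimes>\<^sub>M lborel) (?g -` ?E)"
    by (subst lborel_vector_3, subst emeasure_distr) (use E in \<open>simp_all add: lborel_prod\<close>)
  also have "\<dots> = (\<integral>\<^sup>+p. emeasure lborel (Pair p -` (?g -` ?E)) \<partial>lborel)"
    by (rule lborel.emeasure_pair_measure_alt[OF E'])
  also have "\<dots> = (\<integral>\<^sup>+p. ennreal (2 * half_chord a b p) \<partial>lborel)"
  proof (rule nn_integral_cong)
    fix p :: "real \<times> real"
    have "Pair p -` (?g -` ?E) = {z. (fst p)\<^sup>2 + (snd p)\<^sup>2 + z\<^sup>2 \<le> 1 \<and> a * (fst p)\<^sup>2 + b * (snd p)\<^sup>2 < z\<^sup>2}"
      by (cases p) (auto simp: norm3)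
    then show "emeasure lborel (Pair p -` (?g -` ?E)) = ennreal (2 * half_chord a b p)"
      using emeasure_chord[OF assms] by simp
  qed
  also have "\<dots> = ennreal (\<integral>p. 2 * half_chord a b p \<partial>lborel)"
    by (rule nn_integral_eq_integral) (use integrable_half_chord[OF assms] half_chord_nonneg in auto)
  also have "(\<integral>p. 2 * half_chord a b p \<partial>lborel) = 2 * half_cone_volume a b"
    by (simp add: half_cone_volume_def)
  finally have "emeasure lborel ?E = ennreal (2 * half_cone_volume a b)" .
  moreover have "0 \<le> half_cone_volume a b"
    unfolding half_cone_volume_def by (simp add: half_chord_nonneg)
  ultimately have "measure lborel ?E = 2 * half_cone_volume a b"
    by (simp add: measure_def)
  then show ?thesis using E by (simp add: measure_completion)
qed

section \<open>Matrices diagonal in an orthonormal frame\<close>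

definition orthonormal_frame :: "real^3 \<Rightarrow> real^3 \<Rightarrow> real^3 \<Rightarrow> bool" where
  "orthonormal_frame u v c \<longleftrightarrow> u \<bullet> u = 1 \<and> v \<bullet> v = 1 \<and> c \<bullet> c = 1 \<and> u \<bullet> v = 0 \<and> u \<bullet> c = 0 \<and> v \<bullet> c = 0"

lemma orthonormal_frame_inner:
  assumes "orthonormal_frame u v c"
  shows "u \<bullet> u = 1" "v \<bullet> v = 1" "c \<bullet> c = 1" "u \<bullet> v = 0" "v \<bullet> u = 0" "u \<bullet> c = 0" "c \<bullet> u = 0"
    "v \<bullet> c = 0" "c \<bullet> v = 0"
  using assms by (simp_all add: orthonormal_frame_def inner_commute)

definition frame_map :: "real^3 \<Rightarrow> real^3 \<Rightarrow> real^3 \<Rightarrow> real^3 \<Rightarrow> real^3" where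
  "frame_map u v c y = y$1 *\<^sub>R u + y$2 *\<^sub>R v + y$3 *\<^sub>R c"

lemma frame_map_inner:
  assumes "orthonormal_frame u v c"
  shows "frame_map u v c y \<bullet> u = y$1" "frame_map u v c y \<bullet> v = y$2" "frame_map u v c y \<bullet> c = y$3"
  by (simp_all add: frame_map_def inner_add_left orthonormal_frame_inner[OF assms])

lemma orthogonal_transformation_frame_map:
  assumes f: "orthonormal_frame u v c"
  shows "orthogonal_transformation (frame_map u v c)"
  unfolding orthogonal_transformation_def
proof (intro conjI allI)
  show "linear (frame_map u v c)"
    by (rule linearI) (simp_all add: frame_map_def algebra_simps)
  fix y z
  have "frame_map u v c y \<bullet> frame_map u v c z = z$1 * (frame_map u v c y \<bullet> u) + z$2 * (frame_map u v c y \<bullet> v)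
      + z$3 * (frame_map u v c y \<bullet> c)"
    by (subst (2) frame_map_def) (simp add: inner_add_right)
  then show "frame_map u v c y \<bullet> frame_map u v c z = y \<bullet> z"
    unfolding frame_map_inner[OF f] by (simp add: inner_vec_def sum_3)
qed

lemma frame_map_surj:
  assumes "orthonormal_frame u v c"
  obtains y where "x = frame_map u v c y"
  using orthogonal_transformation_surj[OF orthogonal_transformation_frame_map[OF assms]] by (metis surjD)

lemma frame_expansion:
  assumes "orthonormal_frame u v c"
  shows "x = (x \<bullet> u) *\<^sub>R u + (x \<bullet> v) *\<^sub>R v + (x \<bullet> c) *\<^sub>R c"
proof -
  obtain y where "x = frame_map u v c y" by (rule frame_map_surj[OF assms])
  then show ?thesis by (simp add: frame_map_inner[OF assms]) (simp add: frame_map_def)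
qed

text \<open>This is \<open>a u u\<^sup>T + b v v\<^sup>T - c c\<^sup>T\<close>, the matrix with the eigenvectors \<open>u, v, c\<close> for the
  eigenvalues \<open>a, b, -1\<close>.\<close>

definition axis_matrix :: "real^3 \<Rightarrow> real^3 \<Rightarrow> real^3 \<Rightarrow> real \<Rightarrow> real \<Rightarrow> real^3^3" where
  "axis_matrix u v c a b = (\<chi> i j. a * u$i * u$j + b * v$i * v$j - c$i * c$j)"

lemma axis_matrix_mult:
  "axis_matrix u v c a b *v x = (a * (x \<bullet> u)) *\<^sub>R u + (b * (x \<bullet> v)) *\<^sub>R v - (x \<bullet> c) *\<^sub>R c"
  by (simp add: vec_eq_iff axis_matrix_def matrix_vector_mult_def inner_vec_def sum_3 algebra_simps)

lemma axis_matrix_quadratic_form: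
  "x \<bullet> (axis_matrix u v c a b *v x) = a * (x \<bullet> u)\<^sup>2 + b * (x \<bullet> v)\<^sup>2 - (x \<bullet> c)\<^sup>2"
  by (simp add: axis_matrix_mult inner_add_right inner_diff_right power2_eq_square)

lemma mat_mult_vec: "mat t *v x = t *\<^sub>R (x :: real^'n)"
  by (simp add: vec_eq_iff mat_def matrix_vector_mult_def if_distrib[of "\<lambda>k. k * _"] cong: if_cong)

text \<open>The matrix \<open>R\<close> of the frame intertwines \<^term>\<open>mat t - axis_matrix u v c a b\<close> with
  a diagonal matrix, and \<open>det R \<noteq> 0\<close>.\<close>

lemma det_axis_matrix:
  assumes f: "orthonormal_frame u v c"
  shows "det (mat t - axis_matrix u v c a b) = (t - a) * (t - b) * (t - (-1))"
proof -
  let ?M = "axis_matrix u v c a b"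
  let ?R = "matrix (frame_map u v c)"
  define D :: "real^3^3" where "D = (\<chi> i j. if i = j then (if i = 1 then t - a else if i = 2 then t - b else t + 1) else 0)"
  have lin: "linear (frame_map u v c)"
    using orthogonal_transformation_frame_map[OF f] by (rule orthogonal_transformation_linear)
  have D: "D *v y = vector [(t - a) * y$1, (t - b) * y$2, (t + 1) * y$3]" for y
    by (simp add: D_def vec_eq_iff forall_3 matrix_vector_mult_def sum_3)
  have "(mat t - ?M) ** ?R = ?R ** D"
  proof (subst matrix_eq, rule allI)
    fix y
    have "((mat t - ?M) ** ?R) *v y = (mat t - ?M) *v frame_map u v c y"
      using lin by (simp add: matrix_vector_mul_assoc[symmetric] matrix_works)
    also have "\<dots> = t *\<^sub>R frame_map u v c y - ((a * y$1) *\<^sub>R u + (b * y$2) *\<^sub>R v - y$3 *\<^sub>R c)"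
      by (simp add: matrix_vector_mult_diff_rdistrib mat_mult_vec axis_matrix_mult frame_map_inner[OF f])
    also have "\<dots> = frame_map u v c (D *v y)"
      by (simp add: D frame_map_def algebra_simps)
    finally show "((mat t - ?M) ** ?R) *v y = (?R ** D) *v y"
      using lin by (simp add: matrix_vector_mul_assoc[symmetric] matrix_works)
  qed
  then have "det (mat t - ?M) * det ?R = det ?R * det D"
    by (metis det_mul)
  moreover have "det ?R \<noteq> 0"
    using orthogonal_transformation_frame_map[OF f]
    by (metis det_orthogonal_matrix orthogonal_transformation_matrix zero_neq_one neg_equal_0_iff_equal)
  moreover have "det D = (t - a) * (t - b) * (t - (-1))"
    by (simp add: det_3 D_def)
  ultimately show ?thesis by simp
qed

section \<open>The area of a conic with given axes\<close>

lemma ell_point_eq_iff: "ell_point x = ell_point y \<longleftrightarrow> x = y \<or> x = - y"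
  by (auto simp: ell_point_def doubleton_eq_iff)

text \<open>The sphere covers the elliptic plane twice and both halves of the cone are counted, and the
  area is three times the volume: the constant is \<open>3 * 2 / 2\<close>. The frame is rotated into the standard
  basis.\<close>

lemma conic_area_axis_matrix:
  assumes f: "orthonormal_frame u v c" and ab: "0 \<le> a" "0 \<le> b"
  shows "conic_area (axis_matrix u v c a b) = 3 * half_cone_volume a b"
proof -
  let ?Q = "\<lambda>x. a * (x \<bullet> u)\<^sup>2 + b * (x \<bullet> v)\<^sup>2 < (x \<bullet> c)\<^sup>2"
  let ?E = "{w::real^3. norm w \<le> 1 \<and> a * (w$1)\<^sup>2 + b * (w$2)\<^sup>2 < (w$3)\<^sup>2}"
  have "?Q c" "c \<in> sphere 0 1"
    by (simp_all add: orthonormal_frame_inner[OF f] norm_eq_1)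
  have lift: "sphere_lift (conic_interior (axis_matrix u v c a b)) = {x \<in> sphere 0 1. ?Q x}"
    by (auto simp: sphere_lift_def conic_interior_def axis_matrix_quadratic_form ell_point_eq_iff image_iff)
  have solid_cone: "{r *\<^sub>R x | r x. 0 \<le> r \<and> r \<le> 1 \<and> x \<in> {x \<in> sphere 0 1. ?Q x}}
      = insert 0 {w. norm w \<le> 1 \<and> ?Q w}" (is "?L = ?R")
  proof (intro equalityI subsetI)
    fix w assume "w \<in> ?L"
    then obtain r x where w: "w = r *\<^sub>R x" "0 \<le> r" "r \<le> 1" "norm x = 1" "?Q x" by auto
    show "w \<in> ?R"
    proof (cases "r = 0")
      case False
      then have "r\<^sup>2 * (a * (x \<bullet> u)\<^sup>2 + b * (x \<bullet> v)\<^sup>2) < r\<^sup>2 * (x \<bullet> c)\<^sup>2"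
        using w(5) by simp
      then have "?Q w" by (simp add: w(1) power_mult_distrib algebra_simps)
      then show ?thesis using w by simp
    qed (use w in simp)
  next
    fix w assume w: "w \<in> ?R"
    show "w \<in> ?L"
    proof (cases "w = 0")
      case True
      then show ?thesis using \<open>?Q c\<close> \<open>c \<in> sphere 0 1\<close> by (intro CollectI exI[of _ 0] exI[of _ c]) auto
    next
      case False
      then have w: "norm w \<le> 1" "?Q w" using w by auto
      have "(1 / norm w)\<^sup>2 * (a * (w \<bullet> u)\<^sup>2 + b * (w \<bullet> v)\<^sup>2) < (1 / norm w)\<^sup>2 * (w \<bullet> c)\<^sup>2"
        using w(2) False by (intro mult_strict_left_mono) auto
      then have "?Q (sgn w)"
        by (simp add: sgn_div_norm power_mult_distrib power_divide divide_simps algebra_simps)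
      then show ?thesis using w False
        by (intro CollectI exI[of _ "norm w"] exI[of _ "sgn w"]) (auto simp: norm_sgn sgn_div_norm)
    qed
  qed
  have rotate: "{w. norm w \<le> 1 \<and> ?Q w} = frame_map u v c ` ?E"
  proof (intro equalityI subsetI)
    fix w assume w: "w \<in> {w. norm w \<le> 1 \<and> ?Q w}"
    obtain y where y: "w = frame_map u v c y" by (rule frame_map_surj[OF f])
    show "w \<in> frame_map u v c ` ?E"
      using w orthogonal_transformation_norm[OF orthogonal_transformation_frame_map[OF f]]
      unfolding y by (auto simp: frame_map_inner[OF f])
  qed (auto simp: frame_map_inner[OF f] orthogonal_transformation_norm[OF orthogonal_transformation_frame_map[OF f]])
  have E: "?E \<in> lmeasurable"
  proof (rule bounded_set_imp_lmeasurable)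
    show "bounded ?E" by (rule boundedI[of _ 1]) auto
    show "?E \<in> sets lebesgue" by (rule sets_completionI_sets) (simp add: cone_in_borel)
  qed
  have "measure lebesgue (insert 0 (frame_map u v c ` ?E)) = measure lebesgue (frame_map u v c ` ?E)"
    by (rule measure_negligible_symdiff)
       (use measurable_orthogonal_image[OF orthogonal_transformation_frame_map[OF f] E] in
         \<open>auto intro: negligible_subset[of "{0}"]\<close>)
  also have "\<dots> = 2 * half_cone_volume a b"
    using measure_orthogonal_image[OF orthogonal_transformation_frame_map[OF f] E] measure_cone[OF ab] by simp
  finally show ?thesis
    unfolding conic_area_def elliptic_area_def sphere_area_def lift solid_cone rotate by simp
qed

section \<open>Lines as axes\<close>

lemma line_through_eqD:
  assumes "line_through c u = line_through c' u'"
  shows "span {c, u} = span {c', u'}"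
proof -
  have le: "span {c, u} \<subseteq> span {c', u'}" if eq: "line_through c u = line_through c' u'" for c u c' u'
  proof
    fix x assume x: "x \<in> span {c, u}"
    show "x \<in> span {c', u'}"
    proof (cases "x = 0")
      case False
      have "sgn x \<in> span {c, u}" using x by (simp add: sgn_div_norm span_mul)
      then have "ell_point (sgn x) \<in> line_through c' u'"
        unfolding eq[symmetric] unfolding line_through_def using False by (auto simp: norm_sgn)
      then obtain y where "y \<in> span {c', u'}" "sgn x = y \<or> sgn x = - y"
        unfolding line_through_def by (auto simp: ell_point_eq_iff)
      then have "sgn x \<in> span {c', u'}" by (auto simp: span_neg)
      then have "norm x *\<^sub>R sgn x \<in> span {c', u'}" by (rule span_mul)
      then show ?thesis by (simp add: sgn_div_norm False)
    qed (simp add: span_zero)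
  qed
  show ?thesis using le[OF assms] le[OF assms[symmetric]] by blast
qed

lemma line_through_sgn:
  assumes "c \<noteq> 0" "u \<noteq> 0"
  shows "line_through (sgn c) (sgn u) = line_through c u"
proof -
  have "span {sgn c, sgn u} = span {c, u}"
  proof (rule subset_antisym)
    have "c \<in> span {c, u}" "u \<in> span {c, u}" by (simp_all add: span_base)
    then show "span {sgn c, sgn u} \<subseteq> span {c, u}"
      by (intro span_minimal) (simp_all add: sgn_div_norm span_mul)
    have "norm c *\<^sub>R sgn c \<in> span {sgn c, sgn u}" "norm u *\<^sub>R sgn u \<in> span {sgn c, sgn u}"
      by (intro span_mul span_base; simp)+
    then have "{c, u} \<subseteq> span {sgn c, sgn u}" using assms by (simp add: sgn_div_norm)
    then show "span {c, u} \<subseteq> span {sgn c, sgn u}"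
      by (rule span_minimal) simp
  qed
  then show ?thesis by (simp add: line_through_def)
qed

lemma orthogonal_lines_frame:
  assumes "orthogonal_lines X Y"
  obtains u v c where "orthonormal_frame u v c" "X = line_through c u" "Y = line_through c v"
proof -
  obtain c u v where *: "c \<noteq> 0" "u \<noteq> 0" "v \<noteq> 0" "c \<bullet> u = 0" "c \<bullet> v = 0" "u \<bullet> v = 0"
      "X = line_through c u" "Y = line_through c v"
    using assms unfolding orthogonal_lines_def by blast
  then have "orthonormal_frame (sgn u) (sgn v) (sgn c)"
    by (simp add: orthonormal_frame_def sgn_div_norm inner_commute[of u c] inner_commute[of v c] dot_square_norm power2_eq_square)
  then show ?thesis using that * by (metis line_through_sgn)
qed

lemma in_span_pair: "x \<in> span {p, q} \<longleftrightarrow> (\<exists>k l. x = k *\<^sub>R p + l *\<^sub>R q)"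
  by (auto simp: span_insert algebra_simps span_singleton)

text \<open>The vector \<open>c\<close> lies in both planes \<open>span {c', v1}\<close> and \<open>span {c', v2}\<close>, which meet in
  the line of \<open>c'\<close>; so \<open>c\<close> is a multiple of \<open>c'\<close>. In each plane the orthogonal complement of
  \<open>c'\<close> is the line of \<open>v1\<close> or \<open>v2\<close>. Hence \<open>u, v, c\<close> are eigenvectors as well. The eigenvalues
  \<open>l1\<close> and \<open>l2\<close> may come in either order, so that the lemma applies also when the first axis
  belongs to the smaller eigenvalue.\<close>

lemma eigenvectors_of_same_lines:
  fixes M :: "real^3^3"
  assumes f: "orthonormal_frame u v c"
    and M: "conic_eigenvalues M \<nu>1 \<nu>2"
    and nz: "c' \<noteq> 0" "v1 \<noteq> 0" "v2 \<noteq> 0"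
    and l1: "0 < l1" and l2: "0 < l2"
    and ev: "M *v c' = (-1) *\<^sub>R c'" "M *v v1 = l1 *\<^sub>R v1" "M *v v2 = l2 *\<^sub>R v2"
    and orth: "v1 \<bullet> v2 = 0"
    and X: "line_through c u = line_through c' v1" and Y: "line_through c v = line_through c' v2"
  shows "M = axis_matrix u v c l1 l2"
proof -
  have self_adjoint: "y \<bullet> (M *v z) = (M *v y) \<bullet> z" for y z
    using M unfolding conic_eigenvalues_def by (metis dot_lmul_matrix transpose_matrix_vector)
  have "(l1 + 1) * (c' \<bullet> v1) = 0" using self_adjoint[of c' v1] by (simp add: ev algebra_simps)
  then have c1: "c' \<bullet> v1 = 0" using l1 by simp
  have "(l2 + 1) * (c' \<bullet> v2) = 0" using self_adjoint[of c' v2] by (simp add: ev algebra_simps)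
  then have c2: "c' \<bullet> v2 = 0" using l2 by simp
  have sX: "span {c, u} = span {c', v1}" and sY: "span {c, v} = span {c', v2}"
    using line_through_eqD[OF X] line_through_eqD[OF Y] .
  have "c \<in> span {c', v1}" "c \<in> span {c', v2}"
    unfolding sX[symmetric] sY[symmetric] by (simp_all add: span_base)
  then obtain k1 m1 k2 m2 where c: "c = k1 *\<^sub>R c' + m1 *\<^sub>R v1" "c = k2 *\<^sub>R c' + m2 *\<^sub>R v2"
    unfolding in_span_pair by blast
  have "c \<bullet> v1 = 0"
    by (subst c(2)) (use c1 orth in \<open>simp add: inner_add_left inner_commute[of v2]\<close>)
  then have "m1 * (v1 \<bullet> v1) = 0" using c1 by (simp add: c(1) inner_add_left)
  then have cc: "c = k1 *\<^sub>R c'" using nz c(1) by simp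
  have "c \<noteq> 0" using f by (auto simp: orthonormal_frame_def)
  then have k1: "k1 \<noteq> 0" using cc by auto
  have Mc: "M *v c = - c" by (simp add: cc matrix_vector_mult_scaleR ev)
  have parallel: "M *v w = l *\<^sub>R w" if w: "w \<in> span {c', v'}" "w \<bullet> c = 0" and v': "c' \<bullet> v' = 0" "M *v v' = l *\<^sub>R v'" for w v' l
  proof -
    obtain k m where km: "w = k *\<^sub>R c' + m *\<^sub>R v'" using w(1) unfolding in_span_pair by blast
    have "w \<bullet> c = k1 * (k * (c' \<bullet> c'))"
      unfolding km cc using v'(1) by (simp add: inner_add_left inner_commute[of v'])
    then have "k = 0" using w(2) k1 nz(1) by simp
    then show ?thesis by (simp add: km matrix_vector_mult_scaleR v'(2))
  qed
  have "u \<in> span {c', v1}" "v \<in> span {c', v2}"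
    unfolding sX[symmetric] sY[symmetric] by (simp_all add: span_base)
  then have Mu: "M *v u = l1 *\<^sub>R u" and Mv: "M *v v = l2 *\<^sub>R v"
    using parallel c1 c2 ev f by (auto simp: orthonormal_frame_def)
  show ?thesis
  proof (subst matrix_eq, rule allI)
    fix x
    have "M *v x = M *v ((x \<bullet> u) *\<^sub>R u + (x \<bullet> v) *\<^sub>R v + (x \<bullet> c) *\<^sub>R c)"
      using frame_expansion[OF f, of x] by simp
    also have "\<dots> = axis_matrix u v c l1 l2 *v x"
      by (simp add: axis_matrix_mult matrix_vector_right_distrib matrix_vector_mult_scaleR Mu Mv Mc mult.commute)
    finally show "M *v x = axis_matrix u v c l1 l2 *v x" .
  qed
qed

lemma axis_matrix_swap: "axis_matrix v u c b a = axis_matrix u v c a b"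
  by (simp add: axis_matrix_def vec_eq_iff)

lemma orthonormal_frame_swap: "orthonormal_frame u v c \<Longrightarrow> orthonormal_frame v u c"
  by (auto simp: orthonormal_frame_def inner_commute)

lemma axis_matrix_has_axes:
  assumes f: "orthonormal_frame u v c" and ab: "0 < b" "b \<le> a"
  shows "conic_matrix (axis_matrix u v c a b)"
    and "{X, Y} = {line_through c u, line_through c v} \<Longrightarrow> has_axes (axis_matrix u v c a b) X Y"
proof -
  have "transpose (axis_matrix u v c a b) = axis_matrix u v c a b"
    by (simp add: vec_eq_iff transpose_def axis_matrix_def algebra_simps)
  then have ce: "conic_eigenvalues (axis_matrix u v c a b) a b"
    using ab det_axis_matrix[OF f] by (simp add: conic_eigenvalues_def)
  then show "conic_matrix (axis_matrix u v c a b)" by (auto simp: conic_matrix_def)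
  assume XY: "{X, Y} = {line_through c u, line_through c v}"
  have "c \<noteq> 0" "u \<noteq> 0" "v \<noteq> 0" "u \<bullet> v = 0" using f by (auto simp: orthonormal_frame_def)
  moreover have "axis_matrix u v c a b *v c = (-1) *\<^sub>R c" "axis_matrix u v c a b *v u = a *\<^sub>R u"
    "axis_matrix u v c a b *v v = b *\<^sub>R v"
    by (simp_all add: axis_matrix_mult orthonormal_frame_inner[OF f])
  ultimately show "has_axes (axis_matrix u v c a b) X Y"
    unfolding has_axes_def using ce XY by blast
qed

text \<open>The definition of axes orders the eigenvalues but not the lines, so every pair of positive
  coefficients occurs, with the roles of \<open>u\<close> and \<open>v\<close> exchanged if \<open>a < b\<close>.\<close>

lemma conic_with_axes_iff:
  assumes f: "orthonormal_frame u v c"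
  shows "conic_matrix M \<and> has_axes M (line_through c u) (line_through c v)
    \<longleftrightarrow> (\<exists>a b. 0 < a \<and> 0 < b \<and> M = axis_matrix u v c a b)" (is "?L \<longleftrightarrow> ?R")
proof
  assume ?L
  then obtain n1 n2 c' v1 v2 where M: "conic_eigenvalues M n1 n2" 
    and nz: "c' \<noteq> 0" "v1 \<noteq> 0" "v2 \<noteq> 0"
    and ev: "M *v c' = (-1) *\<^sub>R c'" "M *v v1 = n1 *\<^sub>R v1" "M *v v2 = n2 *\<^sub>R v2"
    and orth: "v1 \<bullet> v2 = 0"
    and XY: "{line_through c u, line_through c v} = {line_through c' v1, line_through c' v2}"
    unfolding has_axes_def by (elim conjE exE) (rule that; assumption)
  have n: "0 < n1" "0 < n2" using M by (auto simp: conic_eigenvalues_def)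
  from XY consider "line_through c u = line_through c' v1" "line_through c v = line_through c' v2"
    | "line_through c u = line_through c' v2" "line_through c v = line_through c' v1"
    by (auto simp: doubleton_eq_iff)
  then show ?R
  proof cases
    case 1
    then show ?thesis using eigenvectors_of_same_lines[OF f M nz n ev orth] n by blast
  next
    case 2
    then show ?thesis
      using eigenvectors_of_same_lines[OF f M nz(1,3,2) n(2,1) ev(1,3,2)] orth n
      by (metis inner_commute)
  qed
next
  assume ?R
  then obtain a b where ab: "0 < a" "0 < b" and M: "M = axis_matrix u v c a b" by blast
  show ?L
  proof (cases "b \<le> a")
    case True
    then show ?thesis using axis_matrix_has_axes[OF f ab(2)] M by blast
  next
    case False
    then show ?thesis
      using axis_matrix_has_axes[OF orthonormal_frame_swap[OF f] ab(1), of b] M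
      unfolding axis_matrix_swap[of v u] by (metis insert_commute nle_le)
  qed
qed

section \<open>Parameters of enclosing conics\<close>

lemma full_dimensional_point_off_line:
  assumes F: "F \<subseteq> elliptic_plane" "full_dimensional F" and u: "u \<noteq> 0"
  obtains x where "x \<in> sphere_lift F" "x \<bullet> u \<noteq> 0"
proof (rule ccontr)
  assume "\<not> thesis"
  then have z: "\<And>x. x \<in> sphere_lift F \<Longrightarrow> u \<bullet> x = 0" using that by (auto simp: inner_commute)
  have "F \<subseteq> ell_point ` (sphere 0 1 \<inter> {x. u \<bullet> x = 0})"
  proof
    fix P assume P: "P \<in> F"
    then obtain x where "x \<in> sphere 0 1" "P = ell_point x" using F(1) by (auto simp: elliptic_plane_def)
    then show "P \<in> ell_point ` (sphere 0 1 \<inter> {x. u \<bullet> x = 0})" using z[of x] P by (auto simp: sphere_lift_def)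
  qed
  moreover have "ell_line (ell_point ` (sphere 0 1 \<inter> {x. u \<bullet> x = 0}))"
    unfolding ell_line_def
    using subspace_hyperplane[of u] dim_hyperplane[OF u]
    by (intro exI[of _ "{x. u \<bullet> x = 0}"]) simp
  ultimately show False using F(2) by (auto simp: full_dimensional_def)
qed

text \<open>Zero coefficients are admitted to make the set closed, although they do not belong to
  conics.\<close>

definition enclosing_parameters :: "(real^3) set \<Rightarrow> real^3 \<Rightarrow> real^3 \<Rightarrow> real^3 \<Rightarrow> (real \<times> real) set" where
  "enclosing_parameters S u v c =
    {(a, b). 0 \<le> a \<and> 0 \<le> b \<and> (\<forall>x\<in>S. a * (x \<bullet> u)\<^sup>2 + b * (x \<bullet> v)\<^sup>2 \<le> (x \<bullet> c)\<^sup>2)}"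

lemma convex_enclosing_parameters: "convex (enclosing_parameters S u v c)"
proof (rule convexI)
  fix p q :: "real \<times> real" and s t :: real
  assume p: "p \<in> enclosing_parameters S u v c" and q: "q \<in> enclosing_parameters S u v c"
    and st: "0 \<le> s" "0 \<le> t" "s + t = 1"
  have "(s * fst p + t * fst q) * (x \<bullet> u)\<^sup>2 + (s * snd p + t * snd q) * (x \<bullet> v)\<^sup>2 \<le> (x \<bullet> c)\<^sup>2" if "x \<in> S" for x
  proof -
    have "s * (fst p * (x \<bullet> u)\<^sup>2 + snd p * (x \<bullet> v)\<^sup>2) + t * (fst q * (x \<bullet> u)\<^sup>2 + snd q * (x \<bullet> v)\<^sup>2)
        \<le> (x \<bullet> c)\<^sup>2"
      by (rule convex_bound_le[OF _ _ st]) (use p q that in \<open>auto simp: enclosing_parameters_def\<close>)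
    then show ?thesis by (simp add: algebra_simps)
  qed
  then show "s *\<^sub>R p + t *\<^sub>R q \<in> enclosing_parameters S u v c"
    using p q st by (cases p; cases q) (auto simp: enclosing_parameters_def)
qed

lemma compact_enclosing_parameters:
  assumes x: "x1 \<in> S" "x1 \<bullet> u \<noteq> 0" "x2 \<in> S" "x2 \<bullet> v \<noteq> 0"
  shows "compact (enclosing_parameters S u v c)"
proof -
  have eq: "enclosing_parameters S u v c = {p. 0 \<le> fst p} \<inter> {p. 0 \<le> snd p}
      \<inter> (\<Inter>x\<in>S. {p. fst p * (x \<bullet> u)\<^sup>2 + snd p * (x \<bullet> v)\<^sup>2 \<le> (x \<bullet> c)\<^sup>2})"
    by (auto simp: enclosing_parameters_def)
  have "closed (enclosing_parameters S u v c)"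
    unfolding eq by (intro closed_Int closed_INT ballI closed_Collect_le continuous_intros)
  moreover have "enclosing_parameters S u v c
      \<subseteq> cbox (0, 0) ((x1 \<bullet> c)\<^sup>2 / (x1 \<bullet> u)\<^sup>2, (x2 \<bullet> c)\<^sup>2 / (x2 \<bullet> v)\<^sup>2)"
  proof
    fix p assume p: "p \<in> enclosing_parameters S u v c"
    obtain a b where ab: "p = (a, b)" by (cases p)
    have nn: "0 \<le> a" "0 \<le> b" and le: "\<And>x. x \<in> S \<Longrightarrow> a * (x \<bullet> u)\<^sup>2 + b * (x \<bullet> v)\<^sup>2 \<le> (x \<bullet> c)\<^sup>2"
      using p by (auto simp: enclosing_parameters_def ab)
    have "0 \<le> b * (x1 \<bullet> v)\<^sup>2" "0 \<le> a * (x2 \<bullet> u)\<^sup>2" using nn by simp_all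
    then have "a * (x1 \<bullet> u)\<^sup>2 \<le> (x1 \<bullet> c)\<^sup>2" "b * (x2 \<bullet> v)\<^sup>2 \<le> (x2 \<bullet> c)\<^sup>2"
      using le[OF x(1)] le[OF x(3)] by linarith+
    then have "a \<le> (x1 \<bullet> c)\<^sup>2 / (x1 \<bullet> u)\<^sup>2" "b \<le> (x2 \<bullet> c)\<^sup>2 / (x2 \<bullet> v)\<^sup>2"
      using x by (simp_all add: pos_le_divide_eq)
    then show "p \<in> cbox (0, 0) ((x1 \<bullet> c)\<^sup>2 / (x1 \<bullet> u)\<^sup>2, (x2 \<bullet> c)\<^sup>2 / (x2 \<bullet> v)\<^sup>2)"
      using nn by (simp add: ab cbox_Pair_eq)
  qed
  then have "bounded (enclosing_parameters S u v c)"
    by (rule bounded_subset[OF bounded_cbox])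
  ultimately show ?thesis
    by (simp add: compact_eq_bounded_closed)
qed

section \<open>The minimal enclosing conic\<close>

theorem theorem3:
  fixes F X Y :: "(real^3) set set"
  assumes "ell_bounded F"
    and "compactin elliptic_topology F"
    and "full_dimensional F"
    and "ell_line X" and "ell_line Y" and "orthogonal_lines X Y"
    and "\<exists>M. conic_enclosing_with_axes F X Y M"
  shows "\<exists>!C. \<exists>M. C = conic M \<and> is_arg_min conic_area (conic_enclosing_with_axes F X Y) M"
proof -
  obtain u v c where f: "orthonormal_frame u v c" and XY: "X = line_through c u" "Y = line_through c v"
    using \<open>orthogonal_lines X Y\<close> by (rule orthogonal_lines_frame)
  let ?K = "enclosing_parameters (sphere_lift F) u v c"
  have enclosing_iff: "conic_enclosing_with_axes F X Y M
      \<longleftrightarrow> (\<exists>a b. (a, b) \<in> ?K \<and> 0 < a \<and> 0 < b \<and> M = axis_matrix u v c a b)" for M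
  proof -
    have "encloses (axis_matrix u v c a b) F \<longleftrightarrow> (a, b) \<in> ?K" if "0 < a" "0 < b" for a b
      using that by (simp add: encloses_def axis_matrix_quadratic_form enclosing_parameters_def)
    then show ?thesis
      unfolding conic_enclosing_with_axes_def XY using conic_with_axes_iff[OF f, of M] by blast
  qed
  have F: "F \<subseteq> elliptic_plane" using \<open>ell_bounded F\<close> by (simp add: ell_bounded_def)
  have "u \<noteq> 0" "v \<noteq> 0" using f by (auto simp: orthonormal_frame_def)
  then obtain x1 x2 where "x1 \<in> sphere_lift F" "x1 \<bullet> u \<noteq> 0" "x2 \<in> sphere_lift F" "x2 \<bullet> v \<noteq> 0"
    using full_dimensional_point_off_line[OF F \<open>full_dimensional F\<close>] by metis
  then have "compact ?K" by (rule compact_enclosing_parameters)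
  moreover have "?K \<subseteq> {0..} \<times> {0..}" by (auto simp: enclosing_parameters_def)
  moreover obtain a1 b1 where "(a1, b1) \<in> ?K" "0 < a1" "0 < b1"
    using \<open>\<exists>M. conic_enclosing_with_axes F X Y M\<close> enclosing_iff by blast
  ultimately obtain a b where ab: "(a, b) \<in> ?K" "0 < a" "0 < b"
    and min: "\<And>a' b'. (a', b') \<in> ?K \<Longrightarrow> (a', b') \<noteq> (a, b) \<Longrightarrow> half_cone_volume a b < half_cone_volume a' b'"
    using half_cone_volume_unique_minimum convex_enclosing_parameters by metis
  let ?M = "axis_matrix u v c a b"
  have M: "conic_enclosing_with_axes F X Y ?M" using ab enclosing_iff by blast
  have less: "conic_area ?M < conic_area M" if "conic_enclosing_with_axes F X Y M" "M \<noteq> ?M" for M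
  proof -
    obtain a' b' where *: "(a', b') \<in> ?K" "0 < a'" "0 < b'" "M = axis_matrix u v c a' b'"
      using \<open>conic_enclosing_with_axes F X Y M\<close> enclosing_iff by blast
    then have "(a', b') \<noteq> (a, b)" using \<open>M \<noteq> ?M\<close> by auto
    then show ?thesis
      using min[OF *(1)] * ab by (simp add: conic_area_axis_matrix[OF f])
  qed
  have "is_arg_min conic_area (conic_enclosing_with_axes F X Y) M \<longleftrightarrow> M = ?M" for M
    using M less unfolding is_arg_min_def by (metis less_asym)
  then show ?thesis by auto
qed

end
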